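(* Let $\alpha_\nu,\beta_\nu>0$ for $\nu=1,\dots,N$. Assume that $\mathbf{x}^*=(x^{1,*},\dots,x^{N,*})$ is a generalized Nash equilibrium of the GNEP at which the KKT conditions hold for all players with some Lagrange multipliers $\eta^{\nu,*}\in\mathbb{R}^{m_\nu}$, i.e. for every $\nu$, $$0\in\nabla_{x^\nu}\theta_\nu(\mathbf{x}^* )+\sum_{i=1}^{m_\nu}\eta^{\nu,*}_i\nabla_{x^\nu}g^\nu_i(\mathbf{x}^* )+\mathcal{N}_{\mathcal{X}_\nu}(x^{\nu,*}),\qquad x^{\nu,*}\in\mathcal{X}_\nu,$$ $$\eta^{\nu,*}_i\ge0,\quad g^\nu_i(\mathbf{x}^* )\le0,\quad \eta^{\nu,*}_ig^\nu_i(\mathbf{x}^* )=0,\quad i=1,\dots,m_\nu.$$ Then for every $\nu=1,\dots,N$ there exist multipliers $(\lambda^{\nu,*},\mu^{\nu,*})\in\mathbb{R}^{m_\nu}_+\times\mathbb{R}^{m_\nu}$ such that, with $z^{\nu,*}=0$, $$\mathcal{L}_{\alpha\beta}^{\nu}(\mathbf{x}^*,z^{\nu,*},\lambda^{\nu},\mu^{\nu})\le \mathcal{L}_{\alpha\beta}^{\nu}(\mathbf{x}^*,z^{\nu,*},\lambda^{\nu,*},\mu^{\nu,*})\le \mathcal{L}_{\alpha\beta}^{\nu}(x^{\nu},x^{-\nu,*},z^{\nu},\lambda^{\nu,*},\mu^{\nu,*})$$ for all $(x^\nu,z^\nu,\lambda^\nu,\mu^\nu)\in\mathcal{X}_\n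u\times\mathbb{R}^{m_\nu}\times\mathbb{R}^{m_\nu}_+\times\mathbb{R}^{m_\nu}$.
   Context: Generalized Nash equilibrium problem (GNEP): there are $N$ players; player $\nu$ chooses $x^\nu\in\mathbb{R}^{n_\nu}$; $\mathbf{x}=(x^1,\dots,x^N)=(x^\nu,x^{-\nu})\in\mathbb{R}^n$, $n=\sum_\nu n_\nu$, where $x^{-\nu}$ collects the other players' strategies. Given $x^{-\nu}$, player $\nu$ minimizes $\theta_\nu(x^\nu,x^{-\nu})$ over $x^\nu$ in $\mathcal{F}_\nu(x^{-\nu})=\{x^\nu\in\mathcal{X}_\nu : g^\nu_i(x^\nu,x^{-\nu})\le 0,\ i=1,\dots,m_\nu\}$, where $\mathcal{X}_\nu=\{x^\nu\in\mathbb{R}^{n_\nu}: l_\nu\le x^\nu\le u_\nu\}$ is a nonempty box with possibly infinite bounds. Write $g^\nu=(g^\nu_1,\dots,g^\nu_{m_\nu})$. Point $\mathbf{x}^*$ is a generalized Nash equilibrium (GNE) if for every $\nu$, $x^{\nu,*}\in\mathcal{F}_\nu(x^{-\nu,*})$ and $\theta_\nu(x^{\nu,*},x^{-\nu,*})\le\theta_\nu(x^\nu,x^{-\nu,*})$ for all $x^\nu\in\mathcal{F}_\nu(x^{-\nu,*})$. $\mathcal{N}_{\mathcal{X}_\nu}(x^{\nu,*})=\{d\in\mathbb{R}^{n_\nu}: d^T(x^\nu-x^{\nu,*})\le0\ \forall x^\nu\in\mathcal{X}_\nu\}$ is the normal cone. Standing assumption: for every $\nu$ and fixed $x^{-\nu}$,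 $\theta_\nu(\cdot,x^{-\nu})$ and $g^\nu_i(\cdot,x^{-\nu})$ ($i=1,\dots,m_\nu$) are continuously differentiable and convex in $x^\nu$. Proximal-Perturbed Lagrangian: for $\alpha_\nu,\beta_\nu>0$, $$\mathcal{L}_{\alpha\beta}^{\nu}(x^{\nu},x^{-\nu},z^{\nu},\lambda^{\nu},\mu^{\nu})=\theta_\nu(x^\nu,x^{-\nu})+(\lambda^\nu)^T(g^\nu(x^\nu,x^{-\nu})-z^\nu)+(\mu^\nu)^Tz^\nu+\tfrac{\alpha_\nu}{2}\|z^\nu\|^2-\tfrac{\beta_\nu}{2}\|\lambda^\nu-\mu^\nu\|^2,$$ with $z^\nu\in\mathbb{R}^{m_\nu}$, $\lambda^\nu\in\mathbb{R}^{m_\nu}_+$, $\mu^\nu\in\mathbb{R}^{m_\nu}$. *)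

theory Defs
  imports "HOL-Analysis.Analysis"
begin

text \<open>
  Players are the elements of a finite type \<open>'p\<close>.  The joint strategy space, the product of the
  spaces of all players, is \<open>real ^ 'k\<close>; the map \<open>owner :: 'k \<Rightarrow> 'p\<close> says which player controls
  which coordinate.  The dimension of the strategy space of player \<open>\<nu>\<close> is thus the cardinality of
  \<open>{k. owner k = \<nu>}\<close>, and varies with \<open>\<nu>\<close>; the space itself is embedded in \<open>real ^ 'k\<close> as the
  coordinate subspace \<open>block owner \<nu>\<close>, with the inherited Euclidean structure.

  The constraints of player \<open>\<nu>\<close> are indexed by \<open>{1..m \<nu>}\<close>, and a vector of that dimension is a
  function on \<open>nat\<close> of which only the values on \<open>{1..m \<nu>}\<close> are ever used.
\<close>

definition block :: "('k \<Rightarrow> 'p) \<Rightarrow> 'p \<Rightarrow> (real ^ 'k) set" where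
  "block owner \<nu> = {y. \<forall>k. owner k \<noteq> \<nu> \<longrightarrow> y $ k = 0}"

definition strategy :: "('k \<Rightarrow> 'p) \<Rightarrow> 'p \<Rightarrow> real ^ 'k \<Rightarrow> real ^ 'k" where
  "strategy owner \<nu> x = (\<chi> k. if owner k = \<nu> then x $ k else 0)"

text \<open>\<open>deviate owner \<nu> y x\<close> is the joint strategy in which player \<open>\<nu>\<close> plays \<open>y\<close> and every
  other player plays as in \<open>x\<close>.\<close>

definition deviate :: "('k \<Rightarrow> 'p) \<Rightarrow> 'p \<Rightarrow> real ^ 'k \<Rightarrow> real ^ 'k \<Rightarrow> real ^ 'k" where
  "deviate owner \<nu> y x = (\<chi> k. if owner k = \<nu> then y $ k else x $ k)"

text \<open>The function of the variable of player \<open>\<nu>\<close> alone, the others being fixed as in \<open>x\<close>.  It is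
  defined on all of \<open>real ^ 'k\<close>, but depends only on the coordinates of player \<open>\<nu>\<close>; hence it is
  convex or continuously differentiable on \<open>real ^ 'k\<close> iff its restriction to \<open>block owner \<nu>\<close> is,
  and its gradient is the gradient of that restriction.\<close>

definition own_part ::
    "('k \<Rightarrow> 'p) \<Rightarrow> 'p \<Rightarrow> (real ^ 'k \<Rightarrow> real) \<Rightarrow> real ^ 'k \<Rightarrow> real ^ 'k \<Rightarrow> real" where
  "own_part owner \<nu> f x = (\<lambda>y. f (deviate owner \<nu> y x))"

definition continuously_differentiable :: "('a :: real_inner \<Rightarrow> real) \<Rightarrow> bool" where
  "continuously_differentiable f \<longleftrightarrow>
     (\<exists>G. (\<forall>y. GDERIV f y :> G y) \<and> continuous_on UNIV G)"

definition gradient :: "('a :: real_inner \<Rightarrow> real) \<Rightarrow> 'a \<Rightarrow> 'a" where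
  "gradient f y = (THE D. GDERIV f y :> D)"

definition partial_gradient ::
    "('k \<Rightarrow> 'p) \<Rightarrow> 'p \<Rightarrow> (real ^ 'k \<Rightarrow> real) \<Rightarrow> real ^ 'k \<Rightarrow> real ^ 'k" where
  "partial_gradient owner \<nu> f x = gradient (own_part owner \<nu> f x) (strategy owner \<nu> x)"

definition box_set ::
    "('k \<Rightarrow> 'p) \<Rightarrow> ('k \<Rightarrow> ereal) \<Rightarrow> ('k \<Rightarrow> ereal) \<Rightarrow> 'p \<Rightarrow> (real ^ 'k) set" where
  "box_set owner l u \<nu> =
     {y \<in> block owner \<nu>. \<forall>k. owner k = \<nu> \<longrightarrow> l k \<le> ereal (y $ k) \<and> ereal (y $ k) \<le> u k}"

definition feasible_set ::
    "('k \<Rightarrow> 'p) \<Rightarrow> ('k \<Rightarrow> ereal) \<Rightarrow> ('k \<Rightarrow> ereal) \<Rightarrow> ('p \<Rightarrow> nat) \<Rightarrow>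
     ('p \<Rightarrow> nat \<Rightarrow> real ^ 'k \<Rightarrow> real) \<Rightarrow> 'p \<Rightarrow> real ^ 'k \<Rightarrow> (real ^ 'k) set" where
  "feasible_set owner l u m g \<nu> x =
     {y \<in> box_set owner l u \<nu>. \<forall>i\<in>{1..m \<nu>}. g \<nu> i (deviate owner \<nu> y x) \<le> 0}"

definition generalized_nash_equilibrium ::
    "('k \<Rightarrow> 'p) \<Rightarrow> ('k \<Rightarrow> ereal) \<Rightarrow> ('k \<Rightarrow> ereal) \<Rightarrow> ('p \<Rightarrow> nat) \<Rightarrow>
     ('p \<Rightarrow> real ^ 'k \<Rightarrow> real) \<Rightarrow> ('p \<Rightarrow> nat \<Rightarrow> real ^ 'k \<Rightarrow> real) \<Rightarrow> real ^ 'k \<Rightarrow> bool" where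
  "generalized_nash_equilibrium owner l u m \<theta> g x \<longleftrightarrow>
     (\<forall>\<nu>. strategy owner \<nu> x \<in> feasible_set owner l u m g \<nu> x \<and>
          (\<forall>y \<in> feasible_set owner l u m g \<nu> x. \<theta> \<nu> x \<le> \<theta> \<nu> (deviate owner \<nu> y x)))"

text \<open>The normal cone at \<open>y\<close> of a set \<open>X\<close>, formed within the subspace \<open>V\<close>.\<close>

definition normal_cone :: "'a :: real_inner set \<Rightarrow> 'a set \<Rightarrow> 'a \<Rightarrow> 'a set" where
  "normal_cone V X y = {d \<in> V. \<forall>y' \<in> X. d \<bullet> (y' - y) \<le> 0}"

definition kkt_conditions ::
    "('k \<Rightarrow> 'p) \<Rightarrow> ('k \<Rightarrow> ereal) \<Rightarrow> ('k \<Rightarrow> ereal) \<Rightarrow> ('p \<Rightarrow> nat) \<Rightarrow>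
     ('p \<Rightarrow> real ^ 'k \<Rightarrow> real) \<Rightarrow> ('p \<Rightarrow> nat \<Rightarrow> real ^ 'k \<Rightarrow> real) \<Rightarrow>
     'p \<Rightarrow> real ^ 'k \<Rightarrow> (nat \<Rightarrow> real) \<Rightarrow> bool" where
  "kkt_conditions owner l u m \<theta> g \<nu> x \<eta> \<longleftrightarrow>
     (\<exists>d \<in> normal_cone (block owner \<nu>) (box_set owner l u \<nu>) (strategy owner \<nu> x).
        0 = partial_gradient owner \<nu> (\<theta> \<nu>) x
            + (\<Sum>i = 1..m \<nu>. \<eta> i *\<^sub>R partial_gradient owner \<nu> (g \<nu> i) x) + d) \<and>
     strategy owner \<nu> x \<in> box_set owner l u \<nu> \<and>
     (\<forall>i\<in>{1..m \<nu>}. 0 \<le> \<eta> i \<and> g \<nu> i x \<le> 0 \<and> \<eta> i * g \<nu> i x = 0)"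

definition prox_perturbed_lagrangian ::
    "('p \<Rightarrow> nat) \<Rightarrow> ('p \<Rightarrow> real ^ 'k \<Rightarrow> real) \<Rightarrow> ('p \<Rightarrow> nat \<Rightarrow> real ^ 'k \<Rightarrow> real) \<Rightarrow>
     ('p \<Rightarrow> real) \<Rightarrow> ('p \<Rightarrow> real) \<Rightarrow> 'p \<Rightarrow> real ^ 'k \<Rightarrow>
     (nat \<Rightarrow> real) \<Rightarrow> (nat \<Rightarrow> real) \<Rightarrow> (nat \<Rightarrow> real) \<Rightarrow> real" where
  "prox_perturbed_lagrangian m \<theta> g \<alpha> \<beta> \<nu> x z lm \<mu> =
     \<theta> \<nu> x
     + (\<Sum>i = 1..m \<nu>. lm i * (g \<nu> i x - z i))
     + (\<Sum>i = 1..m \<nu>. \<mu> i * z i)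
     + \<alpha> \<nu> / 2 * (L2_set z {1..m \<nu>})\<^sup>2
     - \<beta> \<nu> / 2 * (L2_set (\<lambda>i. lm i - \<mu> i) {1..m \<nu>})\<^sup>2"

end

theory Submission
  imports Defs
begin

text \<open>
  Take \<open>\<lambda> = \<mu> = \<eta>\<close>, the KKT multipliers.  The proximal term then vanishes and the two linear terms
  in \<open>z\<close> cancel, so the perturbed Lagrangian of player \<open>\<nu>\<close> becomes the ordinary convex Lagrangian
  plus the nonnegative term \<open>\<alpha>/2 \<parallel>z\<parallel>\<^sup>2\<close>.  Minimality in \<open>x\<^sup>\<nu>\<close> is the sufficiency of
  stationarity for convex functions, and maximality in \<open>(\<lambda>, \<mu>)\<close> at \<open>z = 0\<close> follows from
  complementary slackness.
\<close>

text \<open>Uniqueness of the Frechet derivative makes the definite description behind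
  \<open>gradient\<close> well defined.\<close>

lemma gradient_eqI:
  assumes "GDERIV f x :> D"
  shows "gradient f x = D"
  unfolding gradient_def
proof (rule the_equality)
  fix D' assume "GDERIV f x :> D'"
  then have "(\<lambda>h. h \<bullet> D') = (\<lambda>h. h \<bullet> D)"
    using assms unfolding gderiv_def by (rule has_derivative_unique)
  then show "D' = D"
    by (metis vector_eq_ldot)
qed (rule assms)

lemma continuously_differentiable_GDERIV:
  assumes "continuously_differentiable f"
  shows "GDERIV f x :> gradient f x"
  using assms gradient_eqI unfolding continuously_differentiable_def by metis

text \<open>Restricting \<open>f\<close> to the line through \<open>x\<close> and \<open>y\<close>
  reduces the claim to the tangent inequality for a convex function of one real variable, with
  tangency at parameter 0 and evaluation at parameter 1.\<close>

lemma convex_on_above_tangent_GDERIV: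
  assumes conv: "convex_on UNIV f" and deriv: "GDERIV f x :> D"
  shows "f x + D \<bullet> (y - x) \<le> f y"
proof -
  let ?\<gamma> = "\<lambda>t::real. x + t *\<^sub>R (y - x)"
  have "convex_on UNIV (\<lambda>t. f (?\<gamma> t))"
  proof (rule convex_onI)
    fix t a b :: real
    assume "0 < t" "t < 1"
    \<comment> \<open>An affine map commutes with convex combinations, so convexity of
      \<open>f\<close> passes to its composition with \<open>?\<gamma>\<close>.\<close>
    moreover have "?\<gamma> ((1 - t) *\<^sub>R a + t *\<^sub>R b) = (1 - t) *\<^sub>R ?\<gamma> a + t *\<^sub>R ?\<gamma> b"
      by (simp add: algebra_simps)
    ultimately show "f (?\<gamma> ((1 - t) *\<^sub>R a + t *\<^sub>R b)) \<le> (1 - t) * f (?\<gamma> a) + t * f (?\<gamma> b)"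
      using convex_onD[OF conv, of t "?\<gamma> a" "?\<gamma> b"] by simp
  qed simp
  \<comment> \<open>By the chain rule the slope at 0 is the directional derivative of
    \<open>f\<close> at \<open>x\<close> along \<open>y - x\<close>.\<close>
  moreover have "((\<lambda>t. f (?\<gamma> t)) has_field_derivative D \<bullet> (y - x)) (at 0)"
  proof -
    have "(?\<gamma> has_derivative (\<lambda>t. t *\<^sub>R (y - x))) (at 0)"
      by (auto intro!: derivative_eq_intros)
    moreover have "(f has_derivative (\<lambda>h. h \<bullet> D)) (at (?\<gamma> 0))"
      using deriv by (simp add: gderiv_def)
    ultimately have "((\<lambda>t. f (?\<gamma> t)) has_derivative (\<lambda>t. (t *\<^sub>R (y - x)) \<bullet> D)) (at 0)"
      by (rule has_derivative_compose)
    then show ?thesis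
      by (simp add: has_field_derivative_def inner_commute mult.commute[of _ "D \<bullet> _"])
  qed
  ultimately have "D \<bullet> (y - x) * (1 - 0) \<le> f (?\<gamma> 1) - f (?\<gamma> 0)"
    by (intro convex_on_imp_above_tangent[where A = UNIV]) auto
  then show ?thesis by simp
qed

lemma deviate_strategy_self: "deviate owner \<nu> (strategy owner \<nu> x) x = x"
  by (simp add: deviate_def strategy_def vec_eq_iff)

text \<open>This is the tangent inequality for \<open>own_part\<close> at the base point
  \<open>strategy owner \<nu> x\<close>, where putting the player's own strategy back gives the
  value \<open>f x\<close>.\<close>

lemma own_part_above_partial_gradient:
  assumes "convex_on UNIV (own_part owner \<nu> f x)"
    and "continuously_differentiable (own_part owner \<nu> f x)"
  shows "f x + partial_gradient owner \<nu> f x \<bullet> (y - strategy owner \<nu> x)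
           \<le> f (deviate owner \<nu> y x)"
  using convex_on_above_tangent_GDERIV[OF assms(1) continuously_differentiable_GDERIV[OF assms(2)],
      of "strategy owner \<nu> x" y]
  by (simp add: own_part_def partial_gradient_def deviate_strategy_self)

text \<open>Add the tangent inequality of the objective to those of the constraints weighted by
  \<open>\<eta>\<close>. By stationarity the total linear term is \<open>- (d \<bullet> ?h)\<close>,
  which is nonnegative because \<open>d\<close> is normal to the box.\<close>

lemma kkt_minimizes_lagrangian:
  fixes x :: "real ^ 'k::finite"
  assumes kkt: "kkt_conditions owner l u m \<theta> g \<nu> x \<eta>"
    and "convex_on UNIV (own_part owner \<nu> (\<theta> \<nu>) x)"
    and "continuously_differentiable (own_part owner \<nu> (\<theta> \<nu>) x)"
    and "\<And>i. i \<in> {1..m \<nu>} \<Longrightarrow> convex_on UNIV (own_part owner \<nu> (g \<nu> i) x)"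
    and "\<And>i. i \<in> {1..m \<nu>} \<Longrightarrow> continuously_differentiable (own_part owner \<nu> (g \<nu> i) x)"
    and y: "y \<in> box_set owner l u \<nu>"
  shows "\<theta> \<nu> x + (\<Sum>i = 1..m \<nu>. \<eta> i * g \<nu> i x)
           \<le> \<theta> \<nu> (deviate owner \<nu> y x) + (\<Sum>i = 1..m \<nu>. \<eta> i * g \<nu> i (deviate owner \<nu> y x))"
proof -
  let ?h = "y - strategy owner \<nu> x"
  let ?D\<theta> = "partial_gradient owner \<nu> (\<theta> \<nu>) x"
  let ?Dg = "\<lambda>i. partial_gradient owner \<nu> (g \<nu> i) x"
  obtain d where d: "d \<in> normal_cone (block owner \<nu>) (box_set owner l u \<nu>) (strategy owner \<nu> x)"
    and stationary: "0 = ?D\<theta> + (\<Sum>i = 1..m \<nu>. \<eta> i *\<^sub>R ?Dg i) + d"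
    and \<eta>: "\<And>i. i \<in> {1..m \<nu>} \<Longrightarrow> 0 \<le> \<eta> i"
    using kkt unfolding kkt_conditions_def by blast
  have "0 = (?D\<theta> + (\<Sum>i = 1..m \<nu>. \<eta> i *\<^sub>R ?Dg i) + d) \<bullet> ?h"
    using stationary by simp
  then have "0 = ?D\<theta> \<bullet> ?h + (\<Sum>i = 1..m \<nu>. \<eta> i * (?Dg i \<bullet> ?h)) + d \<bullet> ?h"
    by (simp add: inner_add_left inner_sum_left)
  moreover have "d \<bullet> ?h \<le> 0"
    using d y by (simp add: normal_cone_def)
  moreover have "\<theta> \<nu> x + ?D\<theta> \<bullet> ?h \<le> \<theta> \<nu> (deviate owner \<nu> y x)"
    using assms by (intro own_part_above_partial_gradient) auto
  \<comment> \<open>Nonnegative multipliers preserve the direction of each constraint's tangent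
    inequality.\<close>
  moreover have "(\<Sum>i = 1..m \<nu>. \<eta> i * (g \<nu> i x + ?Dg i \<bullet> ?h))
      \<le> (\<Sum>i = 1..m \<nu>. \<eta> i * g \<nu> i (deviate owner \<nu> y x))"
    using assms \<eta> by (intro sum_mono mult_left_mono own_part_above_partial_gradient) auto
  ultimately show ?thesis
    by (simp add: distrib_left sum.distrib)
qed

lemma prox_perturbed_lagrangian_diagonal:
  "prox_perturbed_lagrangian m \<theta> g \<alpha> \<beta> \<nu> x z lm lm =
     \<theta> \<nu> x + (\<Sum>i = 1..m \<nu>. lm i * g \<nu> i x) + \<alpha> \<nu> / 2 * (L2_set z {1..m \<nu>})\<^sup>2"
  by (simp add: prox_perturbed_lagrangian_def right_diff_distrib sum_subtractf L2_set_def)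

theorem theorem2:
  fixes owner :: "'k::finite \<Rightarrow> 'p::finite"
    and l u :: "'k \<Rightarrow> ereal"
    and m :: "'p \<Rightarrow> nat"
    and \<theta> :: "'p \<Rightarrow> real ^ 'k \<Rightarrow> real"
    and g :: "'p \<Rightarrow> nat \<Rightarrow> real ^ 'k \<Rightarrow> real"
    and \<alpha> \<beta> :: "'p \<Rightarrow> real"
    and xs :: "real ^ 'k"
    and \<eta> :: "'p \<Rightarrow> nat \<Rightarrow> real"
  assumes box_nonempty: "\<And>\<nu>. box_set owner l u \<nu> \<noteq> {}"
    and \<theta>_C1: "\<And>\<nu> x. continuously_differentiable (own_part owner \<nu> (\<theta> \<nu>) x)"
    and \<theta>_convex: "\<And>\<nu> x. convex_on UNIV (own_part owner \<nu> (\<theta> \<nu>) x)"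
    and g_C1: "\<And>\<nu> i x. i \<in> {1..m \<nu>} \<Longrightarrow>
                 continuously_differentiable (own_part owner \<nu> (g \<nu> i) x)"
    and g_convex: "\<And>\<nu> i x. i \<in> {1..m \<nu>} \<Longrightarrow> convex_on UNIV (own_part owner \<nu> (g \<nu> i) x)"
    and \<alpha>_pos: "\<And>\<nu>. \<alpha> \<nu> > 0"
    and \<beta>_pos: "\<And>\<nu>. \<beta> \<nu> > 0"
    and gne: "generalized_nash_equilibrium owner l u m \<theta> g xs"
    and kkt: "\<And>\<nu>. kkt_conditions owner l u m \<theta> g \<nu> xs (\<eta> \<nu>)"
  shows "\<forall>\<nu>. \<exists>ls ms. (\<forall>i\<in>{1..m \<nu>}. 0 \<le> ls i) \<and>
           (\<forall>y \<in> box_set owner l u \<nu>. \<forall>z lm \<mu>. (\<forall>i\<in>{1..m \<nu>}. 0 \<le> lm i) \<longrightarrow>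
              prox_perturbed_lagrangian m \<theta> g \<alpha> \<beta> \<nu> xs (\<lambda>i. 0) lm \<mu>
                \<le> prox_perturbed_lagrangian m \<theta> g \<alpha> \<beta> \<nu> xs (\<lambda>i. 0) ls ms \<and>
              prox_perturbed_lagrangian m \<theta> g \<alpha> \<beta> \<nu> xs (\<lambda>i. 0) ls ms
                \<le> prox_perturbed_lagrangian m \<theta> g \<alpha> \<beta> \<nu> (deviate owner \<nu> y xs) z ls ms)"
proof
  fix \<nu>
  let ?L = "prox_perturbed_lagrangian m \<theta> g \<alpha> \<beta> \<nu>"
  have \<eta>: "0 \<le> \<eta> \<nu> i" "g \<nu> i xs \<le> 0" "\<eta> \<nu> i * g \<nu> i xs = 0" if "i \<in> {1..m \<nu>}" for i
    using kkt[of \<nu>] that unfolding kkt_conditions_def by blast+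
  \<comment> \<open>Complementary slackness only says that each product vanishes; dropping
    \<open>mult_eq_0_iff\<close> keeps these products from being split into disjunctions.\<close>
  have L_star: "?L xs (\<lambda>i. 0) (\<eta> \<nu>) (\<eta> \<nu>) = \<theta> \<nu> xs"
    by (simp add: prox_perturbed_lagrangian_diagonal L2_set_def sum.neutral \<eta>(3) del: mult_eq_0_iff)
  have "?L xs (\<lambda>i. 0) lm \<mu> \<le> ?L xs (\<lambda>i. 0) (\<eta> \<nu>) (\<eta> \<nu>)"
    if "\<forall>i\<in>{1..m \<nu>}. 0 \<le> lm i" for lm \<mu>
  proof -
    \<comment> \<open>At \<open>z = 0\<close> the linear term in \<open>\<mu>\<close> disappears.
      What remains besides \<open>\<theta> \<nu> xs\<close> is this sum and the negated proximal
      square, so \<open>\<mu>\<close> needs no sign condition.\<close>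
    have "(\<Sum>i = 1..m \<nu>. lm i * g \<nu> i xs) \<le> 0"
      using that \<eta>(2) by (intro sum_nonpos mult_nonneg_nonpos) auto
    moreover have "0 \<le> \<beta> \<nu> / 2 * (L2_set (\<lambda>i. lm i - \<mu> i) {1..m \<nu>})\<^sup>2"
      using \<beta>_pos[of \<nu>] by simp
    ultimately show ?thesis
      unfolding L_star by (simp add: prox_perturbed_lagrangian_def L2_set_def)
  qed
  moreover have "?L xs (\<lambda>i. 0) (\<eta> \<nu>) (\<eta> \<nu>) \<le> ?L (deviate owner \<nu> y xs) z (\<eta> \<nu>) (\<eta> \<nu>)"
    if "y \<in> box_set owner l u \<nu>" for y z
  proof -
    have "0 \<le> \<alpha> \<nu> / 2 * (L2_set z {1..m \<nu>})\<^sup>2"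
      using \<alpha>_pos[of \<nu>] by simp
    then show ?thesis
      using kkt_minimizes_lagrangian[OF kkt \<theta>_convex \<theta>_C1 g_convex g_C1 that]
      by (simp add: prox_perturbed_lagrangian_diagonal L2_set_def)
  qed
  \<comment> \<open>Both witnesses \<open>ls\<close> and \<open>ms\<close> are
    \<open>\<eta> \<nu>\<close>.\<close>
  ultimately show "\<exists>ls ms. (\<forall>i\<in>{1..m \<nu>}. 0 \<le> ls i) \<and>
           (\<forall>y \<in> box_set owner l u \<nu>. \<forall>z lm \<mu>. (\<forall>i\<in>{1..m \<nu>}. 0 \<le> lm i) \<longrightarrow>
              ?L xs (\<lambda>i. 0) lm \<mu> \<le> ?L xs (\<lambda>i. 0) ls ms \<and>
              ?L xs (\<lambda>i. 0) ls ms \<le> ?L (deviate owner \<nu> y xs) z ls ms)"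
    using \<eta>(1) by blast
qed

end
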